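(* Let $\boldsymbol f\colon\mathbb R^d\to\mathbb R^p$ be a function that is $r$-times differentiable at $\boldsymbol c\in\mathbb R^d$, for some $r>1$, and consider its $(r-1)$th vectorized derivative $\mathsf D^{\otimes(r-1)}\boldsymbol f$. If $\mathbf B\in\mathcal M_{d\times pd^{r-1}}$ satisfies $\mathsf d\{\mathsf D^{\otimes(r-1)}\boldsymbol f\}(\boldsymbol c;\boldsymbol u)=\mathbf B^\top\boldsymbol u$ for all $\boldsymbol u\in\mathbb R^d$, then $\mathsf D^{\otimes r}\boldsymbol f(\boldsymbol c)=\operatorname{vec}\mathbf B$.
   Context: Vectors are column vectors; $\mathcal M_{m\times n}$ is the set of real $m\times n$ matrices; $\operatorname{vec}$ stacks the columns of a matrix underneath each other. Differentiability: a real function $f$ on $\mathbb R^d$ is once differentiable at $\boldsymbol c$ in the usual (Fréchet) sense; for $r>1$, it is $r$ times differentiable at $\boldsymbol c$ if it is $(r-1)$ times differentiable in a neighborhood of $\boldsymbol c$ and all its partial derivatives of order $r-1$ are differentiable at $\boldsymbol c$. A vector-valued function is $r$ times differentiable if all its components are. For scalar $f$, $\mathsf D^{\otimes r}f(\boldsymbol c)\in\mathbb R^{d^r}$ is the vector whose entry at position $1+\sum_{j=1}^r(i_j-1)d^{r-j}$ is $\frac{\partial^r f}{\partial x_{i_1}\cdots\partial x_{i_r}}(\boldsymbol c)$. For $\boldsymbol f=(f_1,\dots,f_p)$, $\mathsf D^{\otimes r}\boldsymbol f(\boldsymbol c)\in\mathbb R^{pd^r}$ is obtained by stacking $\mathsf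 D^{\otimes r}f_1(\boldsymbol c),\dots,\mathsf D^{\otimes r}f_p(\boldsymbol c)$ underneath each other. For a vector-valued function $\boldsymbol g$ on $\mathbb R^d$, $\mathsf d\boldsymbol g(\boldsymbol c;\boldsymbol u)$ denotes its first differential (Fréchet derivative) at $\boldsymbol c$ applied to $\boldsymbol u$; here $\boldsymbol g=\mathsf D^{\otimes(r-1)}\boldsymbol f$, which takes values in $\mathbb R^{pd^{r-1}}$ and is defined in a neighborhood of $\boldsymbol c$. *)

theory Defs
  imports "HOL-Analysis.Analysis"
begin

(* Coordinates of real ^ 'a are ordered by the linear order of the index type 'a.
   Positions are counted from 0. *)
definition pos :: "'a::{finite,linorder} \<Rightarrow> nat" where
  "pos i = card {j. j < i}"

definition multi_pos :: "'d::{finite,linorder} list \<Rightarrow> nat" where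
  "multi_pos is = (\<Sum>j<length is. pos (is ! j) * CARD('d) ^ (length is - 1 - j))"

definition partial_deriv :: "'d::finite \<Rightarrow> (real ^ 'd \<Rightarrow> real) \<Rightarrow> real ^ 'd \<Rightarrow> real" where
  "partial_deriv i f x = deriv (\<lambda>t. f (x + t *\<^sub>R axis i 1)) 0"

(* iter_partial [i1, ..., ir] f is d^r f / dx_i1 ... dx_ir in the usual reading of this
   notation: the differentiation with respect to x_ir is carried out first. *)
definition iter_partial :: "'d::finite list \<Rightarrow> (real ^ 'd \<Rightarrow> real) \<Rightarrow> real ^ 'd \<Rightarrow> real" where
  "iter_partial is f = foldr partial_deriv is f"

(* Only r > 0 is meaningful; the value at 0 is a convention. *)
fun times_differentiable_at :: "nat \<Rightarrow> (real ^ 'd::finite \<Rightarrow> real) \<Rightarrow> real ^ 'd \<Rightarrow> bool" where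
  "times_differentiable_at 0 f c \<longleftrightarrow> True"
| "times_differentiable_at (Suc 0) f c \<longleftrightarrow> f differentiable (at c)"
| "times_differentiable_at (Suc (Suc k)) f c \<longleftrightarrow>
     (\<forall>\<^sub>F x in nhds c. times_differentiable_at (Suc k) f x) \<and>
     (\<forall>is. length is = Suc k \<longrightarrow> iter_partial is f differentiable (at c))"

definition vec_times_differentiable_at ::
    "nat \<Rightarrow> (real ^ 'd::finite \<Rightarrow> real ^ 'p::finite) \<Rightarrow> real ^ 'd \<Rightarrow> bool" where
  "vec_times_differentiable_at r f c \<longleftrightarrow> (\<forall>a. times_differentiable_at r (\<lambda>x. f x $ a) c)"

(* The result type real ^ 'm is intended for CARD('m) = CARD('p) * CARD('d) ^ r; in that case
   vec_deriv_nth and ex_vec_deriv_pos show that every entry is well defined. *)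
definition vec_deriv ::
    "nat \<Rightarrow> (real ^ 'd::{finite,linorder} \<Rightarrow> real ^ 'p::{finite,linorder}) \<Rightarrow> real ^ 'd::{finite,linorder}
      \<Rightarrow> real ^ 'm::{finite,linorder}" where
  "vec_deriv r f c = (\<chi> k. THE y. \<exists>a is. length is = r \<and>
      pos k = pos a * CARD('d) ^ r + multi_pos is \<and> y = iter_partial is (\<lambda>x. f x $ a) c)"

(* Column stacking. A matrix with rows indexed by 'd and columns by 'm has type real ^ 'm ^ 'd;
   the result type real ^ 'n is intended for CARD('n) = CARD('m) * CARD('d), see
   vectorize_nth and ex_vectorize_pos. *)
definition vectorize :: "real ^ 'm::{finite,linorder} ^ 'd::{finite,linorder}
      \<Rightarrow> real ^ 'n::{finite,linorder}" where
  "vectorize B = (\<chi> k. THE y. \<exists>s i. pos k = pos s * CARD('d) + pos i \<and> y = B $ i $ s)"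

lemma pos_less_card: "pos (i :: 'a::{finite,linorder}) < CARD('a)"
  unfolding pos_def by (rule psubset_card_mono) auto

lemma pos_strict_mono: "i < j \<Longrightarrow> pos (i :: 'a::{finite,linorder}) < pos j"
  unfolding pos_def by (rule psubset_card_mono) auto

lemma pos_inject: "pos (i :: 'a::{finite,linorder}) = pos j \<longleftrightarrow> i = j"
  by (metis less_irrefl linorder_neqE pos_strict_mono)

lemma ex_pos: "n < CARD('a) \<Longrightarrow> \<exists>i :: 'a::{finite,linorder}. pos i = n"
proof -
  assume "n < CARD('a)"
  moreover have "range (pos :: 'a \<Rightarrow> nat) = {..<CARD('a)}"
  proof (rule card_subset_eq)
    have "inj (pos :: 'a \<Rightarrow> nat)"
      by (rule injI) (simp add: pos_inject)
    then show "card (range (pos :: 'a \<Rightarrow> nat)) = card {..<CARD('a)}"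
      by (simp add: card_image)
  qed (auto simp: pos_less_card)
  ultimately have "n \<in> range (pos :: 'a \<Rightarrow> nat)"
    by simp
  then show ?thesis
    by auto
qed

lemma mixed_radix_less:
  fixes a b D :: nat
  assumes "a < A" "b < D"
  shows "a * D + b < A * D"
proof -
  have "a * D + b < Suc a * D"
    using assms by simp
  also have "\<dots> \<le> A * D"
    using assms by (intro mult_right_mono) auto
  finally show ?thesis .
qed

lemma mixed_radix_inject:
  fixes a b a' b' D :: nat
  assumes "a * D + b = a' * D + b'" "b < D" "b' < D"
  shows "a = a' \<and> b = b'"
proof -
  have "(a * D + b) div D = a" "(a' * D + b') div D = a'"
    using assms(2,3) by auto
  then have "a = a'"
    using assms(1) by simp
  then show ?thesis
    using assms(1) by simp
qed

lemma multi_pos_Nil [simp]: "multi_pos [] = 0"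
  by (simp add: multi_pos_def)

lemma multi_pos_Cons:
  "multi_pos (i # is) = pos i * CARD('d) ^ length is + multi_pos (is :: 'd::{finite,linorder} list)"
  unfolding multi_pos_def by (simp add: sum.lessThan_Suc_shift del: sum.lessThan_Suc)

lemma multi_pos_less: "multi_pos (is :: 'd::{finite,linorder} list) < CARD('d) ^ length is"
  by (induction "is") (auto simp: multi_pos_Cons intro!: mixed_radix_less pos_less_card)

lemma multi_pos_inject:
  fixes "is" js :: "'d::{finite,linorder} list"
  assumes "length is = length js" "multi_pos is = multi_pos js"
  shows "is = js"
  using assms
proof (induction "is" js rule: list_induct2)
  case (Cons i "is" j js)
  then have "pos i * CARD('d) ^ length is + multi_pos is
      = pos j * CARD('d) ^ length is + multi_pos js"
    by (simp add: multi_pos_Cons)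
  then have "pos i = pos j \<and> multi_pos is = multi_pos js"
    by (rule mixed_radix_inject) (use multi_pos_less Cons.hyps in metis)+
  then show ?case
    using Cons.IH by (simp add: pos_inject)
qed simp

lemma ex_multi_pos:
  "n < CARD('d) ^ r \<Longrightarrow> \<exists>is :: 'd::{finite,linorder} list. length is = r \<and> multi_pos is = n"
proof (induction r arbitrary: n)
  case (Suc r)
  have "n div CARD('d) ^ r < CARD('d)"
    using Suc.prems by (simp add: less_mult_imp_div_less)
  then obtain i :: 'd where i: "pos i = n div CARD('d) ^ r"
    using ex_pos by blast
  obtain "is" :: "'d list" where "length is = r" "multi_pos is = n mod CARD('d) ^ r"
    using Suc.IH[of "n mod CARD('d) ^ r"] by auto
  with i have "length (i # is) = Suc r \<and> multi_pos (i # is) = n"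
    by (simp add: multi_pos_Cons div_mult_mod_eq)
  then show ?case
    by blast
qed simp

lemma vec_deriv_nth:
  fixes f :: "real ^ 'd::{finite,linorder} \<Rightarrow> real ^ 'p::{finite,linorder}"
    and k :: "'m::{finite,linorder}"
  assumes "length is = r" "pos k = pos a * CARD('d) ^ r + multi_pos is"
  shows "vec_deriv r f c $ k = iter_partial is (\<lambda>x. f x $ a) c"
proof -
  have "b = a \<and> js = is"
    if "length js = r" "pos k = pos b * CARD('d) ^ r + multi_pos js" for b :: 'p and js
  proof -
    have "pos b = pos a \<and> multi_pos js = multi_pos is"
      using that assms multi_pos_less[of "is"] multi_pos_less[of js]
      by (intro mixed_radix_inject) auto
    then show ?thesis
      using that assms multi_pos_inject by (metis pos_inject)
  qed
  then show ?thesis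
    unfolding vec_deriv_def using assms by (auto intro!: the_equality)
qed

lemma ex_vec_deriv_pos:
  assumes "CARD('m) = CARD('p) * CARD('d) ^ r"
  shows "\<exists>(a :: 'p::{finite,linorder}) (is :: 'd::{finite,linorder} list). length is = r \<and>
    pos (k :: 'm::{finite,linorder}) = pos a * CARD('d) ^ r + multi_pos is"
proof -
  have "pos k div CARD('d) ^ r < CARD('p)"
    using pos_less_card[of k] assms by (simp add: less_mult_imp_div_less)
  then obtain a :: 'p where "pos a = pos k div CARD('d) ^ r"
    using ex_pos by blast
  moreover obtain "is" :: "'d list" where "length is = r" "multi_pos is = pos k mod CARD('d) ^ r"
    using ex_multi_pos[where 'd = 'd and n = "pos k mod CARD('d) ^ r" and r = r] by auto
  ultimately have "length is = r \<and> pos k = pos a * CARD('d) ^ r + multi_pos is"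
    by (simp add: div_mult_mod_eq)
  then show ?thesis
    by blast
qed

lemma vectorize_nth:
  fixes B :: "real ^ 'm::{finite,linorder} ^ 'd::{finite,linorder}"
    and k :: "'n::{finite,linorder}"
  assumes "pos k = pos s * CARD('d) + pos i"
  shows "vectorize B $ k = B $ i $ s"
proof -
  have "t = s \<and> j = i" if "pos k = pos t * CARD('d) + pos j" for t :: 'm and j :: 'd
  proof -
    have "pos t = pos s \<and> pos j = pos i"
      using that assms by (intro mixed_radix_inject[where D = "CARD('d)"] pos_less_card) auto
    then show ?thesis
      by (simp add: pos_inject)
  qed
  then show ?thesis
    unfolding vectorize_def using assms by (auto intro!: the_equality)
qed

lemma ex_vectorize_pos:
  assumes "CARD('n) = CARD('m) * CARD('d)"
  shows "\<exists>(s :: 'm::{finite,linorder}) (i :: 'd::{finite,linorder}).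
    pos (k :: 'n::{finite,linorder}) = pos s * CARD('d) + pos i"
proof -
  have "pos k div CARD('d) < CARD('m)"
    using pos_less_card[of k] assms by (simp add: less_mult_imp_div_less)
  then obtain s :: 'm where "pos s = pos k div CARD('d)"
    using ex_pos by blast
  moreover obtain i :: 'd where "pos i = pos k mod CARD('d)"
    using ex_pos[where 'a = 'd and n = "pos k mod CARD('d)"] by auto
  ultimately have "pos k = pos s * CARD('d) + pos i"
    by (simp add: div_mult_mod_eq)
  then show ?thesis
    by blast
qed

end

theory Submission
  imports Defs
begin

text \<open>
  Write \<open>k\<close> for the position of an entry of the two vectors. In \<open>vectorize B\<close> it splits as
  \<open>k = s * d + i\<close>, where the row \<open>i\<close> of \<open>B\<close> is the least significant digit and the column \<open>s\<close> is in
  turn the position of a partial derivative \<open>js\<close> of order \<open>r - 1\<close> of a component of \<open>f\<close>. The hypothesis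
  on \<open>B\<close>, evaluated at the \<open>i\<close>-th unit vector, says that this entry is the partial derivative in
  direction \<open>i\<close> of that derivative of order \<open>r - 1\<close>, so \<open>i\<close> is differentiated \<^emph>\<open>last\<close> and the entry
  belongs to the index list \<open>i # js\<close>. In the \<open>r\<close>-th vectorized derivative, however, the position \<open>k\<close>
  belongs to \<open>js @ [i]\<close>, where \<open>i\<close> is differentiated \<^emph>\<open>first\<close>.

  The mathematical content is therefore that \<open>i\<close> can be moved through \<open>js\<close>
  (\<open>iter_partial_rotate\<close>). Continuity of the derivatives of order \<open>r\<close> is not available, nor even
  their existence away from \<open>c\<close>, so the transpositions rest on Young's form of the symmetry theorem
  (\<open>partial_deriv_commute\<close>): two mixed second partial derivatives agree at a point where both first
  partial derivatives are differentiable, if the function itself is differentiable nearby. It holds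
  because the symmetric second difference quotient converges to either of them
  (\<open>second_difference_quotient_tendsto\<close>).
\<close>

section \<open>Symmetry of second partial derivatives\<close>

text \<open>
  The mean value theorem in direction \<open>v\<close> turns the second difference into \<open>h\<close> times a first
  difference of the directional derivative \<open>g'\<close>, both of whose points tend to \<open>c\<close> at speed \<open>h\<close>.
  Differentiability of \<open>g'\<close> at the single point \<open>c\<close> then evaluates it up to \<open>o(h)\<close>. The difference
  quotient is symmetric in \<open>v\<close> and \<open>w\<close>, while the limit is described asymmetrically; this is what
  makes the lemma useful.
\<close>

lemma second_difference_quotient_tendsto:
  fixes g g' :: "'a::real_normed_vector \<Rightarrow> real"
  assumes deriv: "\<forall>\<^sub>F x in nhds c. ((\<lambda>t. g (x + t *\<^sub>R v)) has_field_derivative g' x) (at 0)"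
    and G: "(g' has_derivative G) (at c)"
  shows "((\<lambda>h. (g (c + h *\<^sub>R v + h *\<^sub>R w) - g (c + h *\<^sub>R v) - g (c + h *\<^sub>R w) + g c) / h\<^sup>2)
    \<longlongrightarrow> G w) (at_right 0)"
proof (rule tendstoI)
  fix e :: real
  assume "e > 0"
  interpret G: bounded_linear G
    using G by (rule has_derivative_bounded_linear)
  \<comment> \<open>All points used below lie within \<open>h * L\<close> of \<open>c\<close>. Two of them enter the error term, hence the
     factor 2 in \<open>K\<close>; the summand 1 keeps \<open>K\<close> positive and the final estimate strict.\<close>
  define L where "L = norm v + norm w"
  define K where "K = 2 * L + 1"
  have "L \<ge> 0" "K > 0"
    by (auto simp: L_def K_def intro: add_nonneg_pos)
  obtain d1 where d1: "d1 > 0"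
    and deriv': "\<And>x. dist x c < d1 \<Longrightarrow> ((\<lambda>t. g (x + t *\<^sub>R v)) has_field_derivative g' x) (at 0)"
    using deriv unfolding eventually_nhds_metric by blast
  have "e / K > 0"
    using \<open>e > 0\<close> \<open>K > 0\<close> by simp
  then obtain d2 where d2: "d2 > 0"
    and approx: "\<And>y. norm (y - c) < d2 \<Longrightarrow> norm (g' y - g' c - G (y - c)) \<le> e / K * norm (y - c)"
    using G unfolding has_derivative_at_alt by blast
  define d where "d = min d1 d2 / K"
  have "d > 0"
    using d1 d2 \<open>K > 0\<close> by (simp add: d_def)
  have "dist ((g (c + h *\<^sub>R v + h *\<^sub>R w) - g (c + h *\<^sub>R v) - g (c + h *\<^sub>R w) + g c) / h\<^sup>2) (G w) < e"
    if h: "0 < h" "h < d" for h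
  proof -
    have "h * L \<le> h * K"
      using h \<open>L \<ge> 0\<close> by (intro mult_left_mono) (auto simp: K_def)
    also have "\<dots> < min d1 d2"
      using h \<open>K > 0\<close> by (simp add: d_def field_simps)
    finally have hL: "h * L < min d1 d2" .
    have small: "norm (s *\<^sub>R v + t *\<^sub>R w) \<le> h * L" if "0 \<le> s" "s \<le> h" "0 \<le> t" "t \<le> h" for s t
    proof -
      have "norm (s *\<^sub>R v + t *\<^sub>R w) \<le> s * norm v + t * norm w"
        using that by (intro norm_triangle_le) simp
      also have "\<dots> \<le> h * norm v + h * norm w"
        using that by (intro add_mono mult_right_mono) auto
      finally show ?thesis
        by (simp add: L_def algebra_simps)
    qed
    have shift: "((\<lambda>s. g (c + s *\<^sub>R v + t *\<^sub>R w)) has_field_derivative g' (c + s *\<^sub>R v + t *\<^sub>R w)) (at s)"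
      if st: "0 \<le> s" "s \<le> h" "0 \<le> t" "t \<le> h" for s t
    proof -
      have "dist (c + s *\<^sub>R v + t *\<^sub>R w) c < d1"
        using small[OF st] hL by (simp add: dist_norm add.assoc)
      from deriv'[OF this] show ?thesis
        using DERIV_shift[of "\<lambda>s. g (c + s *\<^sub>R v + t *\<^sub>R w)" _ 0 s]
        by (simp add: algebra_simps)
    qed
    have "\<exists>z. 0 < z \<and> z < h \<and>
      (g (c + h *\<^sub>R v + h *\<^sub>R w) - g (c + h *\<^sub>R v + 0 *\<^sub>R w))
        - (g (c + 0 *\<^sub>R v + h *\<^sub>R w) - g (c + 0 *\<^sub>R v + 0 *\<^sub>R w))
      = (h - 0) * (g' (c + z *\<^sub>R v + h *\<^sub>R w) - g' (c + z *\<^sub>R v + 0 *\<^sub>R w))"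
      using h by (intro MVT2 DERIV_diff shift) auto
    then obtain z where z: "0 < z" "z < h" and mvt:
      "g (c + h *\<^sub>R v + h *\<^sub>R w) - g (c + h *\<^sub>R v) - g (c + h *\<^sub>R w) + g c
        = h * (g' (c + z *\<^sub>R v + h *\<^sub>R w) - g' (c + z *\<^sub>R v))"
      by (auto simp: algebra_simps)
    \<comment> \<open>The errors of the linear approximation of \<open>g'\<close> at the two points; the increments cancel
       up to \<open>h * G w\<close>.\<close>
    define a where "a = g' (c + z *\<^sub>R v + h *\<^sub>R w) - g' c - G (z *\<^sub>R v + h *\<^sub>R w)"
    define b where "b = g' (c + z *\<^sub>R v) - g' c - G (z *\<^sub>R v)"
    have "\<bar>a\<bar> \<le> e / K * norm (z *\<^sub>R v + h *\<^sub>R w)"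
      using approx[of "c + z *\<^sub>R v + h *\<^sub>R w"] small[of z h] z h hL by (simp add: a_def add.assoc)
    also have "\<dots> \<le> e / K * (h * L)"
      using small[of z h] z h \<open>e / K > 0\<close> by (intro mult_left_mono) auto
    finally have a: "\<bar>a\<bar> \<le> e / K * (h * L)" .
    have "\<bar>b\<bar> \<le> e / K * norm (z *\<^sub>R v)"
      using approx[of "c + z *\<^sub>R v"] small[of z 0] z h hL by (simp add: b_def)
    also have "\<dots> \<le> e / K * (h * L)"
      using small[of z 0] z h \<open>e / K > 0\<close> by (intro mult_left_mono) auto
    finally have b: "\<bar>b\<bar> \<le> e / K * (h * L)" .
    have diff_ab: "g' (c + z *\<^sub>R v + h *\<^sub>R w) - g' (c + z *\<^sub>R v) = h * G w + (a - b)"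
      by (simp add: a_def b_def G.add G.scaleR)
    have "(g (c + h *\<^sub>R v + h *\<^sub>R w) - g (c + h *\<^sub>R v) - g (c + h *\<^sub>R w) + g c) / h\<^sup>2 - G w = (a - b) / h"
      unfolding mvt diff_ab using h by (simp add: field_simps power2_eq_square)
    also have "\<bar>\<dots>\<bar> = \<bar>a - b\<bar> / h"
      using h by simp
    also have "\<dots> \<le> 2 * (e / K * (h * L)) / h"
      using a b h by (intro divide_right_mono) linarith+
    also have "\<dots> = e * (2 * L / K)"
      using h by simp
    also have "\<dots> < e * 1"
      using \<open>e > 0\<close> \<open>K > 0\<close> by (intro mult_strict_left_mono) (auto simp: K_def)
    finally show ?thesis
      by (simp add: dist_real_def)
  qed
  then show "\<forall>\<^sub>F h in at_right 0. dist ((g (c + h *\<^sub>R v + h *\<^sub>R w) - g (c + h *\<^sub>R v)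
      - g (c + h *\<^sub>R w) + g c) / h\<^sup>2) (G w) < e"
    using \<open>d > 0\<close> unfolding eventually_at_right_field by auto
qed

lemma has_derivative_imp_directional:
  fixes g :: "'a::real_normed_vector \<Rightarrow> real"
  assumes "(g has_derivative G) (at x)"
  shows "((\<lambda>t. g (x + t *\<^sub>R v)) has_field_derivative G v) (at 0)"
proof -
  interpret G: bounded_linear G
    using assms by (rule has_derivative_bounded_linear)
  have "((\<lambda>t. g (x + t *\<^sub>R v)) has_derivative (\<lambda>t. G (t *\<^sub>R v))) (at 0)"
    by (rule has_derivative_compose[where g = g and f = "\<lambda>t. x + t *\<^sub>R v"])
      (use assms in \<open>auto intro!: derivative_eq_intros\<close>)
  then show ?thesis
    by (simp add: has_field_derivative_def G.scaleR mult_commute_abs)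
qed

lemma partial_deriv_eq_derivative:
  assumes "(g has_derivative G) (at x)"
  shows "partial_deriv i g x = G (axis i 1)"
  unfolding partial_deriv_def
  by (intro DERIV_imp_deriv has_derivative_imp_directional assms)

lemma has_field_derivative_partial_deriv:
  assumes "g differentiable (at x)"
  shows "((\<lambda>t. g (x + t *\<^sub>R axis i 1)) has_field_derivative partial_deriv i g x) (at 0)"
proof -
  from assms obtain G where G: "(g has_derivative G) (at x)"
    unfolding differentiable_def by blast
  show ?thesis
    unfolding partial_deriv_eq_derivative[OF G] by (rule has_derivative_imp_directional[OF G])
qed

text \<open>Young's form of the theorem on mixed partial derivatives.\<close>

lemma partial_deriv_commute:
  fixes g :: "real ^ 'd::finite \<Rightarrow> real"
  assumes near: "\<forall>\<^sub>F x in nhds c. g differentiable (at x)"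
    and "partial_deriv i g differentiable (at c)" "partial_deriv j g differentiable (at c)"
  shows "partial_deriv i (partial_deriv j g) c = partial_deriv j (partial_deriv i g) c"
proof -
  obtain Gi Gj where Gi: "(partial_deriv i g has_derivative Gi) (at c)"
    and Gj: "(partial_deriv j g has_derivative Gj) (at c)"
    using assms(2,3) unfolding differentiable_def by blast
  let ?\<Delta> = "\<lambda>v w h. (g (c + h *\<^sub>R v + h *\<^sub>R w) - g (c + h *\<^sub>R v) - g (c + h *\<^sub>R w) + g c) / h\<^sup>2"
  have ev: "\<forall>\<^sub>F x in nhds c.
      ((\<lambda>t. g (x + t *\<^sub>R axis k 1)) has_field_derivative partial_deriv k g x) (at 0)" for k
    using near by eventually_elim (rule has_field_derivative_partial_deriv)
  have swap: "?\<Delta> v w h = ?\<Delta> w v h" for v w h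
  proof -
    have eq: "c + h *\<^sub>R v + h *\<^sub>R w = c + h *\<^sub>R w + h *\<^sub>R v"
      by (simp add: ac_simps)
    show ?thesis
      unfolding eq by simp
  qed
  have "(?\<Delta> (axis i 1) (axis j 1) \<longlongrightarrow> Gi (axis j 1)) (at_right 0)"
    by (rule second_difference_quotient_tendsto[OF ev Gi])
  moreover have "(?\<Delta> (axis i 1) (axis j 1) \<longlongrightarrow> Gj (axis i 1)) (at_right 0)"
    unfolding swap[where v = "axis i 1" and w = "axis j 1"]
    by (rule second_difference_quotient_tendsto[OF ev Gj])
  ultimately have "Gi (axis j 1) = Gj (axis i 1)"
    by (rule tendsto_unique[OF trivial_limit_at_right_real])
  then show ?thesis
    by (simp add: partial_deriv_eq_derivative[OF Gi] partial_deriv_eq_derivative[OF Gj])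
qed

section \<open>Higher partial derivatives\<close>

lemma partial_deriv_cong_eventually:
  fixes g h :: "real ^ 'd::finite \<Rightarrow> real"
  assumes "\<forall>\<^sub>F x in nhds c. g x = h x"
  shows "partial_deriv i g c = partial_deriv i h c"
proof -
  have "filterlim (\<lambda>t. c + t *\<^sub>R axis i 1) (nhds c) (nhds (0::real))"
    by (rule tendsto_eq_intros filterlim_ident refl | simp)+
  then have "\<forall>\<^sub>F t in nhds (0::real). g (c + t *\<^sub>R axis i 1) = h (c + t *\<^sub>R axis i 1)"
    using assms by (rule eventually_compose_filterlim[rotated])
  then show ?thesis
    unfolding partial_deriv_def by (rule deriv_cong_ev) simp
qed

lemma iter_partial_Nil [simp]: "iter_partial [] g = g"
  by (simp add: iter_partial_def)

lemma iter_partial_Cons: "iter_partial (i # is) g = partial_deriv i (iter_partial is g)"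
  by (simp add: iter_partial_def)

lemma iter_partial_differentiable:
  assumes "times_differentiable_at (Suc (length is)) g c"
  shows "iter_partial is g differentiable (at c)"
  using assms by (cases "length is") auto

text \<open>
  Young's theorem carries \<open>i\<close> past the head of the list. The remaining transpositions take place
  underneath that outer derivative, so they are needed at all points near \<open>c\<close>; there the function has
  one order of differentiability less, which matches the shorter list.
\<close>

lemma iter_partial_rotate:
  fixes g :: "real ^ 'd::finite \<Rightarrow> real"
  assumes "times_differentiable_at (Suc (length js)) g c"
  shows "iter_partial (i # js) g c = iter_partial (js @ [i]) g c"
  using assms
proof (induction js arbitrary: c)
  case (Cons j js)
  have near: "\<forall>\<^sub>F x in nhds c. times_differentiable_at (Suc (length js)) g x"
    using Cons.prems by simp
  have diff: "partial_deriv k (iter_partial js g) differentiable (at c)" for k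
    using iter_partial_differentiable[of "k # js" g c] Cons.prems by (simp add: iter_partial_Cons)
  have "iter_partial (i # j # js) g c = iter_partial (j # i # js) g c"
    unfolding iter_partial_Cons
    by (intro partial_deriv_commute diff eventually_mono[OF near] iter_partial_differentiable)
  also have "\<dots> = partial_deriv j (iter_partial (js @ [i]) g) c"
    unfolding iter_partial_Cons[of j]
    by (intro partial_deriv_cong_eventually eventually_mono[OF near] Cons.IH)
  finally show ?case
    by (simp add: iter_partial_Cons)
qed simp

section \<open>The differential of a vectorized derivative\<close>

lemma multi_pos_snoc:
  fixes "is" :: "'d::{finite,linorder} list"
  shows "multi_pos (is @ [i]) = multi_pos is * CARD('d) + pos i"
  by (induction "is") (auto simp: multi_pos_Cons algebra_simps)

lemma frechet_derivative_vec_nth: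
  fixes F :: "'a::real_normed_vector \<Rightarrow> real ^ 'm::finite"
  assumes "\<And>k. (\<lambda>x. F x $ k) differentiable (at c)"
  shows "((\<lambda>x. F x $ k) has_derivative (\<lambda>u. frechet_derivative F (at c) u $ k)) (at c)"
proof -
  define D where "D k = frechet_derivative (\<lambda>x. F x $ k) (at c)" for k
  have D: "((\<lambda>x. F x $ k) has_derivative D k) (at c)" for k
    unfolding D_def using assms by (simp flip: frechet_derivative_works)
  have "(F has_derivative (\<lambda>u. \<chi> k. D k u)) (at c)"
    using D by (subst has_derivative_componentwise_within)
      (auto simp: Basis_vec_def inner_axis)
  then have "frechet_derivative F (at c) = (\<lambda>u. \<chi> k. D k u)"
    by (rule frechet_derivative_at[symmetric])
  with D show ?thesis
    by simp
qed

lemma transpose_mult_axis_nth: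
  fixes B :: "real ^ 'm::finite ^ 'd::finite"
  shows "(transpose B *v axis i 1) $ s = B $ i $ s"
  by (simp add: matrix_vector_mul_component inner_axis transpose_def)

theorem theorem3:
  fixes f :: "real ^ 'd::{finite,linorder} \<Rightarrow> real ^ 'p::{finite,linorder}"
    and c :: "real ^ 'd::{finite,linorder}"
    and r :: nat
    and B :: "real ^ 'm::{finite,linorder} ^ 'd::{finite,linorder}"
  assumes "CARD('m) = CARD('p) * CARD('d) ^ (r - 1)"
    and "CARD('n::{finite,linorder}) = CARD('p) * CARD('d) ^ r"
    and "r > 1"
    and "vec_times_differentiable_at r f c"
    and "\<forall>u. frechet_derivative (vec_deriv (r - 1) f :: real ^ 'd::{finite,linorder} \<Rightarrow> real ^ 'm::{finite,linorder}) (at c) u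
              = transpose B *v u"
  shows "(vec_deriv r f c :: real ^ 'n::{finite,linorder}) = vectorize B"
proof (rule vec_eq_iff[THEN iffD2], rule allI)
  fix k :: 'n
  let ?F = "vec_deriv (r - 1) f :: real ^ 'd::{finite,linorder} \<Rightarrow> real ^ 'm::{finite,linorder}"
  have power_r: "CARD('d) ^ r = CARD('d) ^ (r - 1) * CARD('d)"
    using assms(3) by (simp add: power_minus_mult del: One_nat_def)
  have smooth: "times_differentiable_at (Suc (length js)) (\<lambda>x. f x $ a) c"
    if "length js = r - 1" for a and js :: "'d list"
    using assms(3,4) that by (simp add: vec_times_differentiable_at_def)
  have diff: "(\<lambda>x. ?F x $ s) differentiable (at c)" for s
  proof -
    obtain a :: 'p and js :: "'d list"
      where js: "length js = r - 1" "pos s = pos a * CARD('d) ^ (r - 1) + multi_pos js"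
      using ex_vec_deriv_pos[OF assms(1)] by blast
    then have "(\<lambda>x. ?F x $ s) = iter_partial js (\<lambda>x. f x $ a)"
      by (simp add: fun_eq_iff vec_deriv_nth)
    then show ?thesis
      using iter_partial_differentiable[OF smooth[OF js(1)]] by simp
  qed
  have "CARD('n) = CARD('m) * CARD('d)"
    using assms(1,2) power_r by simp
  from ex_vectorize_pos[OF this] obtain s :: 'm and i :: 'd
    where k: "pos k = pos s * CARD('d) + pos i"
    by blast
  obtain a :: 'p and js :: "'d list"
    where js: "length js = r - 1" and s: "pos s = pos a * CARD('d) ^ (r - 1) + multi_pos js"
    using ex_vec_deriv_pos[OF assms(1)] by blast
  have "pos k = pos a * CARD('d) ^ r + multi_pos (js @ [i])"
    unfolding k s multi_pos_snoc power_r by (simp add: algebra_simps)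
  then have "(vec_deriv r f c :: real ^ 'n::{finite,linorder}) $ k = iter_partial (js @ [i]) (\<lambda>x. f x $ a) c"
    using js assms(3) by (intro vec_deriv_nth) auto
  also have "\<dots> = iter_partial (i # js) (\<lambda>x. f x $ a) c"
    by (rule iter_partial_rotate[OF smooth[OF js], symmetric])
  also have "\<dots> = partial_deriv i (\<lambda>x. ?F x $ s) c"
    using vec_deriv_nth[OF js s] by (simp add: iter_partial_Cons)
  also have "\<dots> = B $ i $ s"
    unfolding partial_deriv_eq_derivative[OF frechet_derivative_vec_nth[OF diff]]
    by (simp only: assms(5)[rule_format] transpose_mult_axis_nth)
  also have "\<dots> = (vectorize B :: real ^ 'n::{finite,linorder}) $ k"
    by (rule vectorize_nth[OF k, symmetric])
  finally show "(vec_deriv r f c :: real ^ 'n::{finite,linorder}) $ k = (vectorize B :: real ^ 'n::{finite,linorder}) $ k" .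
qed

end
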